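(* Let $p\le N$ be positive integers and let $f:\mathbb{R}^{N\times p}\to\mathbb{R}$ be differentiable. For $\mathbf{S}\in \mathrm{O}(N)$ write $f_{\mathbf{S}}:=f\circ\Phi_{\mathbf{S}}^{-1}:Q_{N,p}(\mathbf{S})\to\mathbb{R}$, and assume that the gradients $\nabla f_{\mathbf{S}}$ are Lipschitz continuous with a common constant, i.e. there is $L>0$ such that for all $\mathbf{S}\in \mathrm{O}(N)$ and all $\mathbf{V}_1,\mathbf{V}_2\in Q_{N,p}(\mathbf{S})$, $$\|\nabla f_{\mathbf{S}}(\mathbf{V}_1)-\nabla f_{\mathbf{S}}(\mathbf{V}_2)\|_F\le L\|\mathbf{V}_1-\mathbf{V}_2\|_F .$$ Let $(\mathbf{V}_n)_{n=0}^\infty$ (together with center points $\mathbf{S}_{[l]}$, index intervals $\mathcal{N}_l$, and index function $\ell$) be generated by the adaptive localized Cayley parametrization (ALCP) strategy described in the context, from some $\mathbf{U}_0\in\mathrm{St}(p,N)$, with alarming condition $$\|[\![\widetilde{\mathbf{V}}_{n+1}]\!]_{11}\|_2+\|[\![\widetilde{\mathbf{V}}_{n+1}]\!]_{21}\|_2>T$$ for some $T>0$. Assume: (i) the strategy incorporates line-search methods of Armijo type (Type A algorithms), i.e. there is a constant $c\in(0,1)$ such that for every $l\in\mathbb{N}_0$ with $\mathcal{N}_l\ne\emptyset$: (a) for every $n\in\mathcal{N}_l$, $\widetilde{\mathbf{V}}_{n+1}=\mathbf{V}_n+\gamma_n\mathbf{D}_n$ with a stepsize $\gamma_n>0$ and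 a search direction $\mathbf{D}_n\in Q_{N,p}(\mathbf{S}_{[l]})$, where $\mathbf{D}_{\min(\mathcal{N}_l)}=-\nabla f_{\mathbf{S}_{[l]}}(\mathbf{V}_{\min(\mathcal{N}_l)})$; (b) for every $n\in\mathcal{N}_l$ with $\nabla f_{\mathbf{S}_{[l]}}(\mathbf{V}_n)\neq\mathbf{0}$, $\langle\nabla f_{\mathbf{S}_{[l]}}(\mathbf{V}_n),\mathbf{D}_n\rangle<0$; (c) for every $n\in\mathcal{N}_l$, $f_{\mathbf{S}_{[l]}}(\mathbf{V}_n+\gamma_n\mathbf{D}_n)\le f_{\mathbf{S}_{[l]}}(\mathbf{V}_n)+c\,\gamma_n\langle\nabla f_{\mathbf{S}_{[l]}}(\mathbf{V}_n),\mathbf{D}_n\rangle$; and moreover (d) if $\widehat{l}:=\max_{n\in\mathbb{N}}\ell(n)$ exists (so that $\mathcal{N}_{\widehat{l}}=[\min(\mathcal{N}_{\widehat{l}}),\infty)\cap\mathbb{N}_0$) and $(\mathbf{V}_n)_{n\in\mathcal{N}_{\widehat{l}}}$ is bounded, then $\liminf_{n\to\infty,\,n\in\mathcal{N}_{\widehat{l}}}\|\nabla f_{\mathbf{S}_{[\widehat{l}]}}(\mathbf{V}_n)\|_F=0$; (ii) $\underline{\gamma}:=\inf\{\gamma_{\min(\mathcal{N}_l)}\mid l\in\mathbb{N}_0,\ \mathcal{N}_l\neq\emptyset\}>0$. Suppose $\|\nabla f_{\mathbf{S}_{[\ell(n)]}}(\mathbf{V}_n)\|_F>0$ for all $n\in\mathbb{N}_0$.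 Then $$\liminf_{n\to\infty}\|\nabla (f\circ\Phi_{\mathbf{S}_{[\ell(n)]}}^{-1})(\mathbf{V}_n)\|_F=0 .$$
   Context: Notation. $\mathbb{N}_0$ is the set of nonnegative integers. $\mathrm{St}(p,N)=\{\mathbf{U}\in\mathbb{R}^{N\times p}\mid \mathbf{U}^{\mathsf T}\mathbf{U}=\mathbf{I}_p\}$, $\mathrm{O}(N)=\mathrm{St}(N,N)$. $\|\cdot\|_2$ is the spectral norm, $\|\cdot\|_F$ the Frobenius norm. For $\mathbf{X}\in\mathbb{R}^{N\times N}$, $[\![\mathbf{X}]\!]_{ij}$ ($i,j\in\{1,2\}$) denotes the $(i,j)$ block in the partition with row and column sizes $p$ and $N-p$ (so $[\![\mathbf{X}]\!]_{11}\in\mathbb{R}^{p\times p}$, $[\![\mathbf{X}]\!]_{21}\in\mathbb{R}^{(N-p)\times p}$). For $\mathbf{S}\in\mathbb{R}^{N\times N}$, $\mathbf{S}=[\mathbf{S}_{\rm le}\ \mathbf{S}_{\rm ri}]$ with $\mathbf{S}_{\rm le}\in\mathbb{R}^{N\times p}$, $\mathbf{S}_{\rm ri}\in\mathbb{R}^{N\times(N-p)}$. For $\mathbf{U}\in\mathbb{R}^{N\times p}$, $\mathbf{U}_{\rm up}\in\mathbb{R}^{p\times p}$ is its upper block (first $p$ rows). (If $p=N$, blocks of size $0$ are absent.) $\mathbf{I}_{N\times p}$ is the first $p$ columns of the $N\times N$ identity $\mathbf{I}$. $\mathrm{Skew}(\mathbf{X})=(\mathbf{X}-\mathbf{X}^{\mathsf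 T})/2$. Generalized Cayley transform. For $\mathbf{S}\in\mathrm{O}(N)$, $$Q_{N,p}(\mathbf{S})=\left\{\begin{bmatrix}\mathbf{A}&-\mathbf{B}^{\mathsf T}\\ \mathbf{B}&\mathbf{0}\end{bmatrix}\ \middle|\ -\mathbf{A}^{\mathsf T}=\mathbf{A}\in\mathbb{R}^{p\times p},\ \mathbf{B}\in\mathbb{R}^{(N-p)\times p}\right\}$$ (the same vector space for every $\mathbf{S}$), with inner product $\langle\mathbf{V}_1,\mathbf{V}_2\rangle=\mathrm{Tr}(\mathbf{V}_1^{\mathsf T}\mathbf{V}_2)$; gradients of functions on $Q_{N,p}(\mathbf{S})$ are taken with respect to this inner product. Let $E_{N,p}(\mathbf{S})=\{\mathbf{U}\in\mathrm{St}(p,N)\mid\det(\mathbf{I}_p+\mathbf{S}_{\rm le}^{\mathsf T}\mathbf{U})=0\}$. The map $\Phi_{\mathbf{S}}:\mathrm{St}(p,N)\setminus E_{N,p}(\mathbf{S})\to Q_{N,p}(\mathbf{S})$ is $$\Phi_{\mathbf{S}}(\mathbf{U})=\begin{bmatrix}\mathbf{A}_{\mathbf{S}}(\mathbf{U})&-\mathbf{B}_{\mathbf{S}}(\mathbf{U})^{\mathsf T}\\ \mathbf{B}_{\mathbf{S}}(\mathbf{U})&\mathbf{0}\end{bmatrix},$$ $$\mathbf{A}_{\mathbf{S}}(\mathbf{U})=2(\mathbf{I}_p+\mathbf{S}_{\rm le}^{\mathsf T}\mathbf{U})^{-\mathsf T}\,\mathrm{Skew}(\mathbf{U}^{\mathsf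 T}\mathbf{S}_{\rm le})\,(\mathbf{I}_p+\mathbf{S}_{\rm le}^{\mathsf T}\mathbf{U})^{-1},\qquad \mathbf{B}_{\mathbf{S}}(\mathbf{U})=-\mathbf{S}_{\rm ri}^{\mathsf T}\mathbf{U}(\mathbf{I}_p+\mathbf{S}_{\rm le}^{\mathsf T}\mathbf{U})^{-1}.$$ It is a diffeomorphism with inverse $\Phi_{\mathbf{S}}^{-1}(\mathbf{V})=\mathbf{S}(\mathbf{I}-\mathbf{V})(\mathbf{I}+\mathbf{V})^{-1}\mathbf{I}_{N\times p}$, $\mathbf{V}\in Q_{N,p}(\mathbf{S})$. Center-point selection. Given $\mathbf{U}\in\mathrm{St}(p,N)$, take a singular value decomposition $\mathbf{U}_{\rm up}=\mathbf{Q}_1\mathbf{\Sigma}\mathbf{Q}_2^{\mathsf T}$ with $\mathbf{Q}_1,\mathbf{Q}_2\in\mathrm{O}(p)$ and $\mathbf{\Sigma}$ diagonal with nonnegative entries, and output $\mathrm{Center}(\mathbf{U}):=\mathrm{diag}(\mathbf{Q}_1\mathbf{Q}_2^{\mathsf T},\mathbf{I}_{N-p})\in\mathrm{O}(N)$. (With $\mathbf{S}=\mathrm{Center}(\mathbf{U})$ it is known that $\mathbf{U}\notin E_{N,p}(\mathbf{S})$ and $\|\Phi_{\mathbf{S}}(\mathbf{U})\|_2\le1$.) ALCP strategy (infinite run). Input $\mathbf{U}_0\in\mathrm{St}(p,N)$. Set $l=0$, $n=0$, $\mathbf{S}_{[0]}=\mathrm{Center}(\mathbf{U}_0)$, $\mathbf{V}_0=\Phi_{\mathbf{S}_{[0]}}(\mathbf{U}_0)$.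 At step $n$, with current center index $l$ and $\mathbf{V}_n\in Q_{N,p}(\mathbf{S}_{[l]})$: a Euclidean optimization algorithm $\mathcal{A}^{\langle l\rangle}$ for $f\circ\Phi_{\mathbf{S}_{[l]}}^{-1}$ produces $\widetilde{\mathbf{V}}_{n+1}\in Q_{N,p}(\mathbf{S}_{[l]})$ from $\mathbf{V}_n$ and information collected since the center $\mathbf{S}_{[l]}$ was introduced; set $\mathbf{U}_{n+1}=\Phi_{\mathbf{S}_{[l]}}^{-1}(\widetilde{\mathbf{V}}_{n+1})$. If the alarming condition holds for $\widetilde{\mathbf{V}}_{n+1}$, set $\mathbf{S}_{[l+1]}=\mathrm{Center}(\mathbf{U}_{n+1})$, $\mathbf{V}_{n+1}=\Phi_{\mathbf{S}_{[l+1]}}(\mathbf{U}_{n+1})\in Q_{N,p}(\mathbf{S}_{[l+1]})$, and replace $l$ by $l+1$; otherwise set $\mathbf{V}_{n+1}=\widetilde{\mathbf{V}}_{n+1}$ and keep $l$. Then $n\leftarrow n+1$ and repeat. $\mathcal{N}_l\subset\mathbb{N}_0$ is the (interval) set of all $n$ such that $\mathbf{S}_{[l]}$ is the center point for $\mathbf{V}_n$ (i.e. $\mathbf{V}_n\in Q_{N,p}(\mathbf{S}_{[l]})$ at step $n$); it is empty if the $l$-th center is never introduced. The nonempty $\mathcal{N}_l$ are consecutive intervals partitioning $\mathbb{N}_0$. $\ell:\mathbb{N}_0\to\mathbb{N}_0$ is defined by $\ell(n)=l$ if and only if $n\in\mathcal{N}_l$. *)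

theory Defs
  imports "HOL-Analysis.Analysis"
begin

(* A real N x p matrix has type real^'p^'n with N = CARD('n) and p = CARD('p).  An injection
   e :: 'p => 'n selects the p "first" indices of 'n; the indices outside range e are the last
   N - p ones.  Thus p <= N, and p = N is the case where e is a bijection.

   As there is no empty type, a block with N - p rows or columns is indexed by all of 'n, and only
   its indices outside range e are meaningful.  When such a block is extracted from a matrix its
   other entries are set to 0, which changes neither products nor norms (for p = N the block is
   0); four_block never looks at them. *)

definition first_cols_id :: "('p::finite \<Rightarrow> 'n::finite) \<Rightarrow> real^'p^'n" where
  "first_cols_id e = (\<chi> i j. if i = e j then 1 else 0)"

definition left_cols :: "('p::finite \<Rightarrow> 'n::finite) \<Rightarrow> real^'n^'n \<Rightarrow> real^'p^'n" where
  "left_cols e S = (\<chi> i j. S $ i $ e j)"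

definition right_cols :: "('p::finite \<Rightarrow> 'n::finite) \<Rightarrow> real^'n^'n \<Rightarrow> real^'n^'n" where
  "right_cols e S = (\<chi> i j. if j \<in> range e then 0 else S $ i $ j)"

definition upper_rows :: "('p::finite \<Rightarrow> 'n::finite) \<Rightarrow> real^'p^'n \<Rightarrow> real^'p^'p" where
  "upper_rows e U = (\<chi> i j. U $ e i $ j)"

definition block11 :: "('p::finite \<Rightarrow> 'n::finite) \<Rightarrow> real^'n^'n \<Rightarrow> real^'p^'p" where
  "block11 e X = (\<chi> i j. X $ e i $ e j)"

definition block21 :: "('p::finite \<Rightarrow> 'n::finite) \<Rightarrow> real^'n^'n \<Rightarrow> real^'p^'n" where
  "block21 e X = (\<chi> i j. if i \<in> range e then 0 else X $ i $ e j)"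

definition four_block ::
  "('p::finite \<Rightarrow> 'n::finite) \<Rightarrow> real^'p^'p \<Rightarrow> real^'n^'p \<Rightarrow> real^'p^'n \<Rightarrow> real^'n^'n \<Rightarrow> real^'n^'n"
where
  "four_block e X11 X12 X21 X22 = (\<chi> i j.
     if i \<in> range e
     then if j \<in> range e then X11 $ inv e i $ inv e j else X12 $ inv e i $ j
     else if j \<in> range e then X21 $ i $ inv e j else X22 $ i $ j)"

definition stiefel :: "(real^'p^'n) set" where
  "stiefel = {U. transpose U ** U = mat 1}"

definition skew_part :: "real^'p^'p \<Rightarrow> real^'p^'p" where
  "skew_part X = (1/2) *\<^sub>R (X - transpose X)"

definition spectral_norm :: "real^'m^'k \<Rightarrow> real" where
  "spectral_norm X = onorm ((*v) X)"

(* The Frobenius inner product and norm are the library's inner and norm on real^'m^'k. *)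
lemma inner_eq_trace: "X \<bullet> Y = trace (transpose X ** Y)" for X Y :: "real^'m^'k"
  by (simp add: inner_vec_def trace_def matrix_matrix_mult_def transpose_def) (rule sum.swap)

(* The space Q_{N,p}(S); it is the same for every S. *)
definition Q_space :: "('p::finite \<Rightarrow> 'n::finite) \<Rightarrow> (real^'n^'n) set" where
  "Q_space e = {four_block e A (- transpose B) B 0 | A B. - transpose A = A}"

(* The transform Phi_S on U in St(p,N) with det (I_p + S_le^T U) \<noteq> 0; for other U the
   value has no meaning. *)
definition cayley ::
  "('p::finite \<Rightarrow> 'n::finite) \<Rightarrow> real^'n^'n \<Rightarrow> real^'p^'n \<Rightarrow> real^'n^'n" where
  "cayley e S U =
     (let M = mat 1 + transpose (left_cols e S) ** U;
          A = 2 *\<^sub>R (transpose (matrix_inv M) ** skew_part (transpose U ** left_cols e S)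
                    ** matrix_inv M);
          B = - (transpose (right_cols e S) ** U ** matrix_inv M)
      in four_block e A (- transpose B) B 0)"

(* The inverse of Phi_S, as a function on Q_space e (where I + V is invertible). *)
definition inv_cayley ::
  "('p::finite \<Rightarrow> 'n::finite) \<Rightarrow> real^'n^'n \<Rightarrow> real^'n^'n \<Rightarrow> real^'p^'n" where
  "inv_cayley e S V = S ** (mat 1 - V) ** matrix_inv (mat 1 + V) ** first_cols_id e"

(* Gradient at V, within the subspace W and for the inherited inner product, of a function of
   which only the values on W matter. *)
definition grad_on :: "'a::euclidean_space set \<Rightarrow> ('a \<Rightarrow> real) \<Rightarrow> 'a \<Rightarrow> 'a" where
  "grad_on W g V = (THE G. G \<in> W \<and> (g has_derivative (\<lambda>H. G \<bullet> H)) (at V within W))"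

(* S is an output of the center-point selection for U.  This is a relation because U_up may have
   several singular value decompositions leading to different outputs. *)
definition is_center ::
  "('p::finite \<Rightarrow> 'n::finite) \<Rightarrow> real^'p^'n \<Rightarrow> real^'n^'n \<Rightarrow> bool" where
  "is_center e U S \<longleftrightarrow>
     (\<exists>Q1 \<Sigma> Q2. orthogonal_matrix Q1 \<and> orthogonal_matrix Q2 \<and>
        (\<forall>i j. i \<noteq> j \<longrightarrow> \<Sigma> $ i $ j = 0) \<and> (\<forall>i. 0 \<le> \<Sigma> $ i $ i) \<and>
        upper_rows e U = Q1 ** \<Sigma> ** transpose Q2 \<and>
        S = four_block e (Q1 ** transpose Q2) 0 0 (mat 1))"

definition alarming :: "('p::finite \<Rightarrow> 'n::finite) \<Rightarrow> real \<Rightarrow> real^'n^'n \<Rightarrow> bool" where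
  "alarming e T V \<longleftrightarrow> spectral_norm (block11 e V) + spectral_norm (block21 e V) > T"

(* An infinite run of the ALCP strategy: l n is the index of the current center at step n, S k is
   the k-th center, and Vt n is the tilde iterate (Vt 0 is not used).  S k is unconstrained if the
   k-th center is never introduced.  Nothing but membership in Q_space e is required of Vt (Suc n)
   here: the Euclidean optimization algorithm is arbitrary. *)
definition alcp_run ::
  "('p::finite \<Rightarrow> 'n::finite) \<Rightarrow> real \<Rightarrow> (nat \<Rightarrow> real^'p^'n) \<Rightarrow> (nat \<Rightarrow> real^'n^'n) \<Rightarrow>
   (nat \<Rightarrow> real^'n^'n) \<Rightarrow> (nat \<Rightarrow> real^'n^'n) \<Rightarrow> (nat \<Rightarrow> nat) \<Rightarrow> bool" where
  "alcp_run e T U V Vt S l \<longleftrightarrow>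
     U 0 \<in> stiefel \<and> l 0 = 0 \<and> is_center e (U 0) (S 0) \<and> V 0 = cayley e (S 0) (U 0) \<and>
     (\<forall>n. Vt (Suc n) \<in> Q_space e \<and>
          U (Suc n) = inv_cayley e (S (l n)) (Vt (Suc n)) \<and>
          (if alarming e T (Vt (Suc n))
           then l (Suc n) = Suc (l n) \<and>
                is_center e (U (Suc n)) (S (Suc (l n))) \<and>
                V (Suc n) = cayley e (S (Suc (l n))) (U (Suc n))
           else l (Suc n) = l n \<and> V (Suc n) = Vt (Suc n)))"

(* The index set N_k, i.e. the steps at which the k-th center is in use; it is empty if that
   center is never introduced. *)
definition steps :: "(nat \<Rightarrow> nat) \<Rightarrow> nat \<Rightarrow> nat set" where
  "steps l k = {n. l n = k}"

definition first_step :: "(nat \<Rightarrow> nat) \<Rightarrow> nat \<Rightarrow> nat" where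
  "first_step l k = (LEAST n. n \<in> steps l k)"

end

(* Changing the center does not move the point U n, since the generalized Cayley transform is
   inverted by inv_cayley at every center point.  Hence the Armijo condition makes f (U n)
   decreasing along the whole run, and it is bounded below because the Stiefel manifold is compact.
   If the center changes infinitely often, each change is followed by a steepest descent step
   which lowers f by at least c * gamma0 * |grad|^2, where gamma0 > 0 is the infimum in (ii); so
   the gradients at these steps tend to 0.  Otherwise the alarm is eventually silent, which bounds
   the iterates, and assumption (d) applies. *)
theory Submission
  imports Defs
begin

subsection \<open>Matrix algebra\<close>

lemma matrix_add_rdistrib: "(A + B) ** C = A ** C + B ** C"
  for A B :: "real^'m^'k" and C :: "real^'q^'m"
  by (simp add: vec_eq_iff matrix_matrix_mult_def algebra_simps sum.distrib)

lemma matrix_diff_ldistrib: "A ** (B - C) = A ** B - A ** C"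
  for A :: "real^'m^'k" and B C :: "real^'q^'m"
  by (simp add: vec_eq_iff matrix_matrix_mult_def algebra_simps sum_subtractf)

lemma matrix_diff_rdistrib: "(A - B) ** C = A ** C - B ** C"
  for A B :: "real^'m^'k" and C :: "real^'q^'m"
  by (simp add: vec_eq_iff matrix_matrix_mult_def algebra_simps sum_subtractf)

lemma matrix_minus_right: "A ** (- B) = - (A ** B)"
  for A :: "real^'m^'k" and B :: "real^'q^'m"
  by (simp add: vec_eq_iff matrix_matrix_mult_def sum_negf)

lemma matrix_minus_left: "(- A) ** B = - (A ** B)"
  for A :: "real^'m^'k" and B :: "real^'q^'m"
  by (simp add: vec_eq_iff matrix_matrix_mult_def sum_negf)

lemma matrix_scaleR_right: "A ** (r *\<^sub>R B) = r *\<^sub>R (A ** B)"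
  for A :: "real^'m^'k" and B :: "real^'q^'m"
  by (simp add: vec_eq_iff matrix_matrix_mult_def sum_distrib_left algebra_simps)

lemma matrix_scaleR_left: "(r *\<^sub>R A) ** B = r *\<^sub>R (A ** B)"
  for A :: "real^'m^'k" and B :: "real^'q^'m"
  by (simp add: vec_eq_iff matrix_matrix_mult_def sum_distrib_left algebra_simps)

lemma matrix_zero_right: "A ** (0 :: real^'q^'m) = 0" for A :: "real^'m^'k"
  by (simp add: vec_eq_iff matrix_matrix_mult_def)

lemma matrix_zero_left: "(0 :: real^'m^'k) ** A = 0" for A :: "real^'q^'m"
  by (simp add: vec_eq_iff matrix_matrix_mult_def)

lemma transpose_add: "transpose (A + B) = transpose A + transpose B"
  for A B :: "real^'m^'k"
  by (simp add: vec_eq_iff transpose_def)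

lemma transpose_diff: "transpose (A - B) = transpose A - transpose B"
  for A B :: "real^'m^'k"
  by (simp add: vec_eq_iff transpose_def)

lemma transpose_minus: "transpose (- A) = - transpose A" for A :: "real^'m^'k"
  by (simp add: vec_eq_iff transpose_def)

lemmas matrix_algebra =
  matrix_add_ldistrib matrix_add_rdistrib matrix_diff_ldistrib matrix_diff_rdistrib
  matrix_minus_right matrix_minus_left matrix_scaleR_right matrix_scaleR_left
  matrix_zero_right matrix_zero_left

lemmas transpose_simps =
  transpose_add transpose_diff transpose_minus transpose_scalar matrix_transpose_mul

section \<open>Inverses of I + K and the classical Cayley transform of a skew-symmetric
  matrix\<close>

lemma matrix_inv_left: "matrix_inv A ** A = mat 1"
  and matrix_inv_right: "A ** matrix_inv A = mat 1"
  if "invertible A" for A :: "real^'m^'m"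
proof -
  have "A ** matrix_inv A = mat 1 \<and> matrix_inv A ** A = mat 1"
    using that unfolding matrix_inv_def invertible_def by (rule someI_ex)
  then show "matrix_inv A ** A = mat 1" "A ** matrix_inv A = mat 1" by auto
qed

text \<open>A kernel vector x gives 0 = |x|^2 + x . Kx, a sum of nonnegative terms. This serves both
  skew-symmetric K, whose quadratic form vanishes, and the positive semidefinite K that arises at a
  center point.\<close>

lemma invertible_mat_1_plus:
  fixes K :: "real^'m^'m"
  assumes "\<And>x. 0 \<le> x \<bullet> (K *v x)"
  shows "invertible (mat 1 + K)"
proof -
  have "x = 0" if "(mat 1 + K) *v x = 0" for x
  proof -
    have "0 = x \<bullet> ((mat 1 + K) *v x)" by (simp add: that)
    also have "\<dots> = x \<bullet> x + x \<bullet> (K *v x)"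
      by (simp add: matrix_vector_mult_add_rdistrib inner_add_right)
    finally show "x = 0"
      using assms[of x] inner_ge_zero[of x] inner_eq_zero_iff[of x] by linarith
  qed
  then show ?thesis
    by (simp add: invertible_left_inverse matrix_left_invertible_ker)
qed

lemma invertible_mat_1_plus_skew:
  fixes K :: "real^'m^'m"
  assumes "transpose K = - K"
  shows "invertible (mat 1 + K)"
proof (rule invertible_mat_1_plus)
  fix x
  have "x \<bullet> (K *v x) = (transpose K *v x) \<bullet> x"
    by (simp add: dot_lmul_matrix)
  also have "\<dots> = - (x \<bullet> (K *v x))"
    by (simp only: assms) (simp add: vec_eq_iff matrix_vector_mult_def inner_vec_def sum_negf mult.commute)
  finally show "0 \<le> x \<bullet> (K *v x)" by simp
qed

text \<open>I + K and I - K commute and are transposes of each other, so in W^T (I + K) (I - K) W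
  each inverse can be moved next to the factor that it cancels.\<close>

lemma orthogonal_matrix_cayley:
  fixes K :: "real^'m^'m"
  assumes "transpose K = - K"
  shows "orthogonal_matrix ((mat 1 - K) ** matrix_inv (mat 1 + K))"
proof -
  let ?W = "matrix_inv (mat 1 + K)"
  have inv: "invertible (mat 1 + K)" by (rule invertible_mat_1_plus_skew[OF assms])
  have tW: "transpose ?W ** (mat 1 - K) = mat 1"
    using arg_cong[OF matrix_inv_right[OF inv], of transpose]
    by (simp add: transpose_simps assms)
  have "transpose ((mat 1 - K) ** ?W) ** ((mat 1 - K) ** ?W)
      = transpose ?W ** ((mat 1 + K) ** (mat 1 - K)) ** ?W"
    by (simp add: transpose_simps assms matrix_mul_assoc)
  also have "(mat 1 + K) ** (mat 1 - K) = (mat 1 - K) ** (mat 1 + K)"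
    by (simp add: matrix_algebra)
  also have "transpose ?W ** ((mat 1 - K) ** (mat 1 + K)) ** ?W
      = (transpose ?W ** (mat 1 - K)) ** ((mat 1 + K) ** ?W)"
    by (simp add: matrix_mul_assoc)
  also have "\<dots> = mat 1" by (simp add: tW matrix_inv_right[OF inv])
  finally show ?thesis by (simp add: orthogonal_matrix)
qed

subsection \<open>Block matrices\<close>

text \<open>The coordinate projection P onto the last N - p indices. With E =
  \<open>first_cols_id e\<close> it satisfies E E^T + P = I, E^T E = I and P E = 0, so block
  computations become algebra in E and P; for p = N it is simply 0.\<close>

definition last_proj :: "('p::finite \<Rightarrow> 'n::finite) \<Rightarrow> real^'n^'n" where
  "last_proj e = (\<chi> i j. if i = j \<and> i \<notin> range e then 1 else 0)"

lemma transpose_last_proj: "transpose (last_proj e) = last_proj e"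
  by (auto simp: last_proj_def transpose_def vec_eq_iff)

lemma last_proj_mult: "(last_proj e ** X) $ i $ j = (if i \<in> range e then 0 else X $ i $ j)"
proof -
  have "(last_proj e ** X) $ i $ j = (\<Sum>k\<in>UNIV. if i = k then (if i \<in> range e then 0 else X $ i $ j) else 0)"
    unfolding last_proj_def matrix_matrix_mult_def vec_lambda_beta by (rule sum.cong) auto
  then show ?thesis by simp
qed

lemma mult_last_proj: "(X ** last_proj e) $ i $ j = (if j \<in> range e then 0 else X $ i $ j)"
proof -
  have "(X ** last_proj e) $ i $ j = transpose (X ** last_proj e) $ j $ i"
    by (simp add: transpose_def)
  then show ?thesis
    by (simp add: matrix_transpose_mul transpose_last_proj last_proj_mult)
      (simp add: transpose_def)
qed

lemma first_cols_id_mult: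
  assumes "inj e"
  shows "(first_cols_id e ** X) $ i $ j = (if i \<in> range e then X $ inv e i $ j else 0)"
proof -
  have "(first_cols_id e ** X) $ i $ j
      = (\<Sum>k\<in>UNIV. if inv e i = k then (if i \<in> range e then X $ inv e i $ j else 0) else 0)"
    unfolding first_cols_id_def matrix_matrix_mult_def vec_lambda_beta
    using assms by (intro sum.cong) auto
  then show ?thesis by simp
qed

lemma mult_transpose_first_cols_id:
  assumes "inj e"
  shows "(X ** transpose (first_cols_id e)) $ i $ j = (if j \<in> range e then X $ i $ inv e j else 0)"
proof -
  have "(X ** transpose (first_cols_id e)) $ i $ j
      = transpose (X ** transpose (first_cols_id e)) $ j $ i"
    by (simp add: transpose_def)
  then show ?thesis
    by (simp add: matrix_transpose_mul first_cols_id_mult[OF assms])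
      (simp add: transpose_def)
qed

lemma left_cols_eq: "left_cols e S = S ** first_cols_id e"
proof -
  have "(\<Sum>k\<in>UNIV. S $ i $ k * (if k = e j then 1 else 0)) = S $ i $ e j" for i j
    using sum.delta[of UNIV "e j" "\<lambda>k. S $ i $ k"]
    by (simp add: if_distrib[of "(*) _"] cong: if_cong)
  then show ?thesis
    by (simp add: left_cols_def first_cols_id_def vec_eq_iff matrix_matrix_mult_def)
qed

lemma right_cols_eq: "right_cols e S = S ** last_proj e"
  by (simp add: right_cols_def vec_eq_iff mult_last_proj)

lemma upper_rows_eq: "upper_rows e U = transpose (first_cols_id e) ** U"
proof -
  have "(\<Sum>k\<in>UNIV. (if k = e i then 1 else 0) * U $ k $ j) = U $ e i $ j" for i j
    using sum.delta[of UNIV "e i" "\<lambda>k. U $ k $ j"]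
    by (simp add: if_distrib[of "\<lambda>t. t * _"] cong: if_cong)
  then show ?thesis
    by (simp add: upper_rows_def first_cols_id_def transpose_def vec_eq_iff matrix_matrix_mult_def)
qed

lemma transpose_first_cols_id_mult_self:
  assumes "inj e"
  shows "transpose (first_cols_id e) ** first_cols_id e = mat 1"
  unfolding upper_rows_eq[symmetric] using assms
  by (auto simp: upper_rows_def first_cols_id_def mat_def vec_eq_iff inj_eq)

lemma first_cols_id_mult_transpose:
  assumes "inj e"
  shows "first_cols_id e ** transpose (first_cols_id e) = mat 1 - last_proj e"
proof -
  have "(first_cols_id e ** transpose (first_cols_id e)) $ i $ j = (mat 1 - last_proj e) $ i $ j"
    for i j
    by (simp add: first_cols_id_mult[OF assms])
      (auto simp: transpose_def first_cols_id_def mat_def last_proj_def f_inv_into_f)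
  then show ?thesis by (simp add: vec_eq_iff)
qed

lemma last_proj_mult_first_cols_id:
  "last_proj e ** first_cols_id e = 0"
  by (simp add: vec_eq_iff last_proj_mult) (auto simp: first_cols_id_def)

lemma transpose_first_cols_id_mult_last_proj:
  "transpose (first_cols_id e) ** last_proj e = 0"
  using arg_cong[OF last_proj_mult_first_cols_id[of e], of transpose]
  by (simp add: matrix_transpose_mul transpose_last_proj) (simp add: transpose_def vec_eq_iff)

lemma last_proj_idem: "last_proj e ** last_proj e = last_proj e"
  by (simp add: vec_eq_iff last_proj_mult) (auto simp: last_proj_def)

text \<open>The factors P on either side discard exactly those entries that
  \<open>four_block\<close> never reads. From here on block matrices are handled through the
  relations between E and P, not entry by entry.\<close>

lemma four_block_eq:
  assumes "inj e"
  shows "four_block e X11 X12 X21 X22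
    = first_cols_id e ** X11 ** transpose (first_cols_id e) + first_cols_id e ** X12 ** last_proj e
      + last_proj e ** X21 ** transpose (first_cols_id e) + last_proj e ** X22 ** last_proj e"
  by (simp add: vec_eq_iff four_block_def mult_last_proj last_proj_mult
      first_cols_id_mult[OF assms] mult_transpose_first_cols_id[OF assms])

subsection \<open>The generalized Cayley transform\<close>

text \<open>Skew symmetry is what makes I + X invertible and (I - X) (I + X)^(-1)
  orthogonal.\<close>

lemma transpose_Q_space:
  assumes "inj e" "X \<in> Q_space e"
  shows "transpose X = - X"
proof -
  obtain A B where A: "- transpose A = A" and X: "X = four_block e A (- transpose B) B 0"
    using assms(2) by (auto simp: Q_space_def)
  have A': "transpose A = - A" using A by (metis minus_minus)
  show ?thesis
    unfolding X four_block_eq[OF assms(1)]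
    by (simp add: transpose_simps A' transpose_last_proj matrix_algebra matrix_mul_assoc)
qed

lemma inv_cayley_in_stiefel:
  assumes "inj e" "orthogonal_matrix S" "X \<in> Q_space e"
  shows "inv_cayley e S X \<in> stiefel"
proof -
  let ?R = "S ** ((mat 1 - X) ** matrix_inv (mat 1 + X))"
  have "orthogonal_matrix ?R"
    using orthogonal_matrix_mul[OF assms(2)
      orthogonal_matrix_cayley[OF transpose_Q_space[OF assms(1,3)]]] .
  then have R: "transpose ?R ** ?R = mat 1" by (simp add: orthogonal_matrix)
  have "transpose (?R ** first_cols_id e) ** (?R ** first_cols_id e)
      = transpose (first_cols_id e) ** (transpose ?R ** ?R) ** first_cols_id e"
    by (simp only: matrix_transpose_mul matrix_mul_assoc)
  also have "\<dots> = mat 1"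
    unfolding R by (simp add: transpose_first_cols_id_mult_self[OF assms(1)])
  finally show ?thesis
    by (simp add: stiefel_def inv_cayley_def matrix_mul_assoc)
qed

text \<open>The (1,1) block is a congruence K^T (.) K of a skew-symmetric matrix, hence
  skew-symmetric whatever K is; so U may even lie in the singular set.\<close>

lemma cayley_in_Q_space: "cayley e S U \<in> Q_space e"
proof -
  define K where "K = matrix_inv (mat 1 + transpose (left_cols e S) ** U)"
  define A where "A = 2 *\<^sub>R (transpose K ** skew_part (transpose U ** left_cols e S) ** K)"
  have "- transpose A = A"
    by (simp add: A_def skew_part_def transpose_simps matrix_algebra matrix_mul_assoc algebra_simps)
  then show ?thesis
    unfolding Q_space_def cayley_def Let_def K_def[symmetric] A_def[symmetric] by blast
qed

text \<open>With \<open>E = I_(N x p)\<close>, \<open>Z = S^T U\<close> and \<open>V = cayley e S U\<close>, the claim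
  \<open>(I - V) (I + V)^(-1) E = Z\<close> is equivalent to \<open>(I + V) (Z + E) = 2 E\<close>.\<close>

lemma inv_cayley_cayley:
  assumes e: "inj e" and S: "orthogonal_matrix S" and U: "U \<in> stiefel"
    and inv: "invertible (mat 1 + transpose (left_cols e S) ** U)"
  shows "inv_cayley e S (cayley e S U) = U"
proof -
  define E where "E = first_cols_id e"
  define P where "P = last_proj e"
  define Z where "Z = transpose S ** U"
  define M where "M = mat 1 + transpose E ** Z"
  define K where "K = matrix_inv M"
  \<comment> \<open>The factor 2 of the transform cancels the 1/2 of \<open>skew_part\<close>, and
    U^T S_le = Z^T E.\<close>
  define A where "A = transpose K ** (transpose Z ** E - transpose E ** Z) ** K"
  define B where "B = - (P ** Z ** K)"
  define W where "W = cayley e S U"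
  have EE: "transpose E ** E = mat 1"
    and EtE: "E ** transpose E = mat 1 - P" and PE: "P ** E = 0" and EP: "transpose E ** P = 0"
    and PP: "P ** P = P" and tP: "transpose P = P"
    unfolding E_def P_def
    by (simp_all add: transpose_first_cols_id_mult_self[OF e] first_cols_id_mult_transpose[OF e]
        last_proj_mult_first_cols_id transpose_first_cols_id_mult_last_proj last_proj_idem
        transpose_last_proj)
  have M: "mat 1 + transpose (left_cols e S) ** U = M"
    by (simp add: M_def Z_def E_def left_cols_eq matrix_transpose_mul matrix_mul_assoc)
  have ZZ: "transpose Z ** Z = mat 1"
  proof -
    have "transpose Z ** Z = transpose U ** (S ** transpose S) ** U"
      by (simp add: Z_def matrix_transpose_mul matrix_mul_assoc)
    then show ?thesis
      using S U by (simp add: orthogonal_matrix_def stiefel_def)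
  qed
  have SZ: "S ** Z = U"
    using S by (simp add: Z_def matrix_mul_assoc orthogonal_matrix_def)
  have KM: "K ** M = mat 1"
    using inv unfolding M K_def by (rule matrix_inv_left)
  have tKM: "transpose K ** transpose M = mat 1"
    using arg_cong[OF matrix_inv_right[OF inv[unfolded M]], of transpose]
    by (simp add: matrix_transpose_mul K_def)
  have W: "W = E ** A ** transpose E - E ** transpose B ** P + P ** B ** transpose E"
  proof -
    have "2 *\<^sub>R (transpose K ** skew_part (transpose U ** left_cols e S) ** K) = A"
      by (simp add: A_def skew_part_def Z_def left_cols_eq E_def transpose_simps matrix_algebra
          matrix_mul_assoc)
    moreover have "- (transpose (right_cols e S) ** U ** K) = B"
      by (simp add: B_def right_cols_eq P_def Z_def matrix_transpose_mul transpose_last_proj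
          matrix_mul_assoc)
    ultimately have "W = four_block e A (- transpose B) B 0"
      unfolding W_def cayley_def Let_def M K_def[symmetric] by simp
    then show ?thesis
      by (simp add: four_block_eq[OF e] E_def P_def matrix_algebra)
  qed
  have PB: "P ** B = B"
    by (simp add: B_def matrix_algebra matrix_mul_assoc PP)
  have BP: "transpose B ** P = transpose B"
    using arg_cong[OF PB, of transpose] by (simp add: matrix_transpose_mul tP)
  \<comment> \<open>This explains the choice of Z + E: its upper block is M, so multiplying W by it
    cancels the inverses K on the right of A and B.\<close>
  have EZE: "transpose E ** (Z + E) = M"
    by (simp add: M_def matrix_algebra EE add.commute)
  have BM: "B ** M = - (P ** Z)"
    by (simp add: B_def matrix_algebra matrix_mul_assoc[symmetric] KM)
  have BZE: "transpose B ** P ** (Z + E) = - (transpose K ** (transpose Z ** P ** Z))"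
  proof -
    have "transpose B ** P ** (Z + E) = transpose B ** P ** Z"
      by (simp add: matrix_algebra matrix_mul_assoc[symmetric] PE)
    also have "\<dots> = transpose B ** Z" by (simp only: BP)
    also have "\<dots> = - (transpose K ** (transpose Z ** P ** Z))"
      by (simp add: B_def transpose_simps tP matrix_algebra matrix_mul_assoc)
    finally show ?thesis .
  qed
  have AM: "A ** M = transpose K ** (transpose Z ** E - transpose E ** Z)"
  proof -
    have "A ** M = transpose K ** (transpose Z ** E - transpose E ** Z) ** (K ** M)"
      by (simp only: A_def matrix_mul_assoc)
    then show ?thesis by (simp add: KM)
  qed
  have ZPZ: "transpose Z ** P ** Z = mat 1 - transpose Z ** E ** (transpose E ** Z)"
  proof -
    have "transpose Z ** E ** (transpose E ** Z) = transpose Z ** (E ** transpose E) ** Z"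
      by (simp only: matrix_mul_assoc)
    then show ?thesis by (simp add: EtE matrix_algebra ZZ)
  qed
  have MM: "M = transpose K ** (transpose M ** M)"
    by (simp add: matrix_mul_assoc tKM)
  \<comment> \<open>This is the upper block of (I + W) (Z + E). Put X = E^T Z, so M = I + X. After
    K^T = M^(-T) is factored out, M^T M + (X^T - X) + (I - X^T X) collapses to 2 M^T.\<close>
  have core: "M + A ** M + transpose K ** (transpose Z ** P ** Z) = 2 *\<^sub>R mat 1"
  proof -
    have "M + A ** M + transpose K ** (transpose Z ** P ** Z)
      = transpose K ** (transpose M ** M + (transpose Z ** E - transpose E ** Z)
          + transpose Z ** P ** Z)"
      by (simp only: AM matrix_add_ldistrib MM[symmetric])
    also have "transpose M ** M + (transpose Z ** E - transpose E ** Z) + transpose Z ** P ** Z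
        = 2 *\<^sub>R transpose M"
      unfolding ZPZ by (simp add: M_def transpose_simps matrix_algebra scaleR_2 algebra_simps)
    also have "transpose K ** (2 *\<^sub>R transpose M) = 2 *\<^sub>R mat 1"
      by (simp add: matrix_algebra tKM)
    finally show ?thesis .
  qed
  have WZE: "W ** (Z + E) = E ** (A ** M) + E ** (transpose K ** (transpose Z ** P ** Z)) - P ** Z"
  proof -
    have "W ** (Z + E) = E ** (A ** (transpose E ** (Z + E))) - E ** (transpose B ** P ** (Z + E))
        + P ** B ** (transpose E ** (Z + E))"
      by (simp only: W matrix_diff_rdistrib matrix_add_rdistrib matrix_mul_assoc)
    then show ?thesis unfolding EZE BZE PB BM
      by (simp only: matrix_minus_right diff_minus_eq_add add_uminus_conv_diff)
  qed
  \<comment> \<open>The term - P Z from the lower block of W (Z + E) cancels the lower block of Z +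
    E, so only a multiple of E remains.\<close>
  have EM: "Z + E - P ** Z = E ** M"
    by (simp add: M_def matrix_algebra matrix_mul_assoc EtE)
  have "(mat 1 + W) ** (Z + E) = Z + E + W ** (Z + E)"
    by (simp only: matrix_add_rdistrib matrix_mul_lid)
  also have "\<dots> = E ** (M + A ** M + transpose K ** (transpose Z ** P ** Z))"
    by (simp only: WZE) (simp only: matrix_add_ldistrib EM[symmetric], simp)
  also have "\<dots> = 2 *\<^sub>R E" by (simp add: core matrix_algebra)
  finally have key: "(mat 1 + W) ** (Z + E) = 2 *\<^sub>R E" .
  let ?J = "matrix_inv (mat 1 + W)"
  have "invertible (mat 1 + W)"
    unfolding W_def
    by (intro invertible_mat_1_plus_skew transpose_Q_space[OF e] cayley_in_Q_space)
  then have J: "?J ** (mat 1 + W) = mat 1" "(mat 1 + W) ** ?J = mat 1"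
    by (rule matrix_inv_left, rule matrix_inv_right)
  have JE: "2 *\<^sub>R (?J ** E) = Z + E"
    using arg_cong[OF key, of "(**) ?J"] by (simp add: matrix_mul_assoc J matrix_scaleR_right)
  \<comment> \<open>Writing I - W = 2 I - (I + W) reduces the claim to the value of (I + W)^(-1) E,
    which \<open>key\<close> provides.\<close>
  have "(mat 1 - W) ** ?J = (2 *\<^sub>R mat 1 - (mat 1 + W)) ** ?J"
    by (simp add: scaleR_2)
  also have "\<dots> = 2 *\<^sub>R ?J - mat 1" by (simp only: matrix_diff_rdistrib matrix_scaleR_left J matrix_mul_lid)
  finally have "(mat 1 - W) ** ?J ** E = 2 *\<^sub>R (?J ** E) - E"
    by (simp add: matrix_algebra)
  then have "(mat 1 - W) ** ?J ** E = Z" by (simp add: JE)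
  then have "S ** ((mat 1 - W) ** ?J ** E) = U" by (simp add: SZ)
  then show ?thesis
    unfolding inv_cayley_def W_def[symmetric] E_def[symmetric] by (simp add: matrix_mul_assoc)
qed

section \<open>Center points: orthogonality, and invertibility of I + S_le^T U\<close>

lemma orthogonal_matrix_center:
  fixes e :: "'p::finite \<Rightarrow> 'n::finite"
  assumes "inj e" "is_center e U S"
  shows "orthogonal_matrix S"
proof -
  obtain Q1 Q2 where Q: "orthogonal_matrix Q1" "orthogonal_matrix Q2"
    and S: "S = four_block e (Q1 ** transpose Q2) 0 0 (mat 1)"
    using assms(2) by (auto simp: is_center_def)
  let ?E = "first_cols_id e" and ?P = "last_proj e" and ?R = "Q1 ** transpose Q2"
  have "orthogonal_matrix ?R"
    using Q by (simp add: orthogonal_matrix_mul)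
  then have R: "transpose ?R ** ?R = mat 1" by (simp add: orthogonal_matrix)
  have S': "S = ?E ** ?R ** transpose ?E + ?P"
    by (simp add: S four_block_eq[OF assms(1)] matrix_algebra last_proj_idem)
  \<comment> \<open>Cancellation rules with a trailing factor X, since products are associated to
    the right below.\<close>
  have 1: "transpose ?E ** (?E ** X) = X" for X :: "real^'n^'p"
    by (simp add: matrix_mul_assoc transpose_first_cols_id_mult_self[OF assms(1)])
  have 2: "?P ** (?E ** X) = 0" for X :: "real^'n^'p"
    by (simp add: matrix_mul_assoc last_proj_mult_first_cols_id matrix_zero_left)
  have 3: "transpose Q1 ** (Q1 ** X) = X" for X :: "real^'n^'p"
    using Q by (simp add: matrix_mul_assoc orthogonal_matrix)
  have 4: "Q2 ** (transpose Q2 ** X) = X" for X :: "real^'n^'p"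
    using Q by (simp add: matrix_mul_assoc orthogonal_matrix_def)
  have "transpose S ** S = mat 1"
    unfolding S'
    by (simp add: transpose_simps matrix_algebra transpose_last_proj matrix_mul_assoc[symmetric]
        1 2 3 4 last_proj_idem first_cols_id_mult_transpose[OF assms(1)]
        transpose_first_cols_id_mult_last_proj)
  then show ?thesis by (simp add: orthogonal_matrix)
qed

text \<open>For a center point, \<open>I + S_le^T U = I + Q2 \<Sigma> Q2^T\<close>.\<close>

lemma invertible_center:
  fixes e :: "'p::finite \<Rightarrow> 'n::finite"
  assumes "inj e" "is_center e U S"
  shows "invertible (mat 1 + transpose (left_cols e S) ** U)"
proof -
  obtain Q1 Q2 and D :: "real^'p^'p" where Q: "orthogonal_matrix Q1" "orthogonal_matrix Q2"
    and D: "\<And>i j. i \<noteq> j \<Longrightarrow> D $ i $ j = 0" "\<And>i. 0 \<le> D $ i $ i"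
    and U: "upper_rows e U = Q1 ** D ** transpose Q2"
    and S: "S = four_block e (Q1 ** transpose Q2) 0 0 (mat 1)"
    using assms(2) by (auto simp: is_center_def)
  let ?E = "first_cols_id e" and ?P = "last_proj e"
  have "left_cols e S = ?E ** (Q1 ** transpose Q2)"
    by (simp add: left_cols_eq S four_block_eq[OF assms(1)] matrix_algebra last_proj_idem
        matrix_mul_assoc[symmetric] transpose_first_cols_id_mult_self[OF assms(1)]
        last_proj_mult_first_cols_id)
  \<comment> \<open>S_le vanishes outside its upper block, so only U_up enters; inserting its
    singular value decomposition brings Q1^T Q1 together.\<close>
  then have "transpose (left_cols e S) ** U = Q2 ** (transpose Q1 ** Q1) ** D ** transpose Q2"
    using U by (simp add: upper_rows_eq matrix_transpose_mul matrix_mul_assoc[symmetric])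
  then have K: "transpose (left_cols e S) ** U = Q2 ** D ** transpose Q2"
    using Q by (simp add: orthogonal_matrix)
  show ?thesis
    unfolding K
  proof (rule invertible_mat_1_plus)
    fix x :: "real^'p"
    let ?y = "transpose Q2 *v x"
    have "x \<bullet> ((Q2 ** D ** transpose Q2) *v x) = ?y \<bullet> (D *v ?y)"
      by (simp add: matrix_vector_mul_assoc[symmetric] dot_lmul_matrix)
    also have "\<dots> = (\<Sum>i\<in>UNIV. D $ i $ i * (?y $ i)\<^sup>2)"
    proof -
      have "(D *v ?y) $ i = D $ i $ i * ?y $ i" for i
      proof -
        have "(D *v ?y) $ i = (\<Sum>j\<in>UNIV. if i = j then D $ i $ i * ?y $ i else 0)"
          unfolding matrix_vector_mult_def[of D] vec_lambda_beta
            using D(1) by (intro sum.cong) auto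
        then show ?thesis by simp
      qed
      then show ?thesis by (simp add: inner_vec_def power2_eq_square algebra_simps)
    qed
    also have "\<dots> \<ge> 0" using D(2) by (intro sum_nonneg mult_nonneg_nonneg) auto
    finally show "0 \<le> x \<bullet> ((Q2 ** D ** transpose Q2) *v x)" .
  qed
qed

subsection \<open>Compactness\<close>

text \<open>The trace of U^T U is p, so every point has Frobenius norm sqrt p; closedness comes from
  the polynomial equations for the entries.\<close>

lemma compact_stiefel: "compact (stiefel :: (real^'p::finite^'n::finite) set)"
proof -
  have "norm X \<le> sqrt (real CARD('p))" if "X \<in> stiefel" for X :: "real^'p^'n"
    using that by (simp add: norm_eq_sqrt_inner inner_eq_trace stiefel_def trace_def mat_def)
  then have "bounded (stiefel :: (real^'p^'n) set)" by (auto simp: bounded_iff)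
  moreover have "stiefel = {X :: real^'p^'n. \<forall>i j. (\<Sum>k\<in>UNIV. X $ k $ i * X $ k $ j) = mat 1 $ i $ j}"
    by (auto simp: stiefel_def vec_eq_iff matrix_matrix_mult_def transpose_def)
  moreover have "closed \<dots>"
    by (intro closed_Collect_all closed_Collect_eq continuous_intros)
  ultimately show ?thesis by (simp add: compact_eq_bounded_closed)
qed

lemma abs_component_le_spectral_norm: "\<bar>X $ i $ j\<bar> \<le> spectral_norm X"
  unfolding spectral_norm_def by (rule matrix_component_le_onorm)

text \<open>The alarm sees only the (1,1) and (2,1) blocks, but on Q these control everything: the
  (1,2) block is minus the transpose of the (2,1) block, and the (2,2) block is zero. Each entry is
  at most a spectral norm, hence at most T in absolute value.\<close>

lemma bounded_not_alarming:
  fixes e :: "'p::finite \<Rightarrow> 'n::finite"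
  assumes "inj e"
  shows "bounded {X \<in> Q_space e. \<not> alarming e T X}"
proof -
  have comp: "\<bar>X $ i $ j\<bar> \<le> T" if X: "X \<in> Q_space e" and al: "\<not> alarming e T X" for X i j
  proof -
    let ?s = "spectral_norm (block11 e X)" and ?t = "spectral_norm (block21 e X)"
    obtain A B where X': "X = four_block e A (- transpose B) B 0"
      using X by (auto simp: Q_space_def)
    have sum: "?s + ?t \<le> T" using al by (simp add: alarming_def)
    have nn: "0 \<le> ?s" "0 \<le> ?t"
      using abs_component_le_spectral_norm order_trans[OF abs_ge_zero] by blast+
    have 11: "\<bar>X $ e a $ e b\<bar> \<le> ?s" for a b
      using abs_component_le_spectral_norm[of "block11 e X" a b] by (simp add: block11_def)
    have 21: "\<bar>X $ k $ e b\<bar> \<le> ?t" if "k \<notin> range e" for k b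
      using abs_component_le_spectral_norm[of "block21 e X" k b] that by (simp add: block21_def)
    have sym: "\<bar>X $ i $ j\<bar> = \<bar>X $ j $ i\<bar>"
      using arg_cong[OF transpose_Q_space[OF assms X], of "\<lambda>Y. Y $ j $ i"]
      by (simp add: transpose_def)
    consider "i \<in> range e" "j \<in> range e" | "i \<notin> range e" "j \<in> range e"
      | "i \<in> range e" "j \<notin> range e" | "i \<notin> range e" "j \<notin> range e" by blast
    then show ?thesis
    proof cases
      case 1
      then obtain a b where "i = e a" "j = e b" by blast
      then show ?thesis using 11[of a b] sum nn by simp
    next
      case 2
      then obtain b where "j = e b" by blast
      then show ?thesis using 21[OF 2(1), of b] sum nn by simp
    next
      case 3
      then obtain b where "i = e b" by blast
      then show ?thesis using 21[OF 3(2), of b] sym sum nn by simp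
    next
      case 4
      then show ?thesis using sum nn by (simp add: X' four_block_def)
    qed
  qed
  have "norm X \<le> (\<Sum>i\<in>(UNIV :: 'n set). \<Sum>j\<in>(UNIV :: 'n set). T)"
    if "X \<in> Q_space e" "\<not> alarming e T X" for X
  proof -
    have "norm (X $ i) \<le> (\<Sum>j\<in>(UNIV :: 'n set). T)" for i
      by (rule order_trans[OF norm_le_l1_cart]) (intro sum_mono comp that)
    moreover have "norm X \<le> (\<Sum>i\<in>UNIV. norm (X $ i))"
      unfolding norm_vec_def by (rule L2_set_le_sum) simp
    ultimately show ?thesis by (meson order_trans sum_mono)
  qed
  then show ?thesis unfolding bounded_iff by blast
qed

subsection \<open>The run of the strategy\<close>

text \<open>The three facts need one joint induction: orthogonality of the current center keeps the
  next point on the manifold, and that in turn lets the transform at a new center be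
  inverted.\<close>

lemma alcp_run_stiefel:
  assumes e: "inj e" and run: "alcp_run e T U V Vt S l"
  shows "U n \<in> stiefel \<and> orthogonal_matrix (S (l n)) \<and> inv_cayley e (S (l n)) (V n) = U n"
proof (induction n)
  case 0
  have "U 0 \<in> stiefel" "is_center e (U 0) (S (l 0))" "V 0 = cayley e (S (l 0)) (U 0)"
    using run by (auto simp: alcp_run_def)
  then show ?case
    by (simp add: orthogonal_matrix_center[OF e]
        inv_cayley_cayley[OF e _ _ invertible_center[OF e]])
next
  case (Suc n)
  have Q: "Vt (Suc n) \<in> Q_space e"
    and U: "U (Suc n) = inv_cayley e (S (l n)) (Vt (Suc n))"
    and step: "if alarming e T (Vt (Suc n))
           then l (Suc n) = Suc (l n) \<and>
                is_center e (U (Suc n)) (S (Suc (l n))) \<and>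
                V (Suc n) = cayley e (S (Suc (l n))) (U (Suc n))
           else l (Suc n) = l n \<and> V (Suc n) = Vt (Suc n)"
    using run unfolding alcp_run_def by blast+
  have st: "U (Suc n) \<in> stiefel"
    unfolding U using Suc Q by (intro inv_cayley_in_stiefel[OF e]) auto
  show ?case
  proof (cases "alarming e T (Vt (Suc n))")
    case True
    then have "is_center e (U (Suc n)) (S (l (Suc n)))"
      "V (Suc n) = cayley e (S (l (Suc n))) (U (Suc n))"
      using step by auto
    then show ?thesis
      by (simp add: st orthogonal_matrix_center[OF e]
          inv_cayley_cayley[OF e _ _ invertible_center[OF e]])
  next
    case False
    then show ?thesis using st step U Suc by simp
  qed
qed

section \<open>Behaviour of the center index along a run\<close>

lemma alcp_run_index:
  assumes "alcp_run e T U V Vt S l"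
  shows alcp_run_index_0: "l 0 = 0"
    and alcp_run_index_mono: "mono l"
    and alcp_run_index_Suc: "l (Suc n) \<le> Suc (l n)"
proof -
  have "l (Suc m) = l m \<or> l (Suc m) = Suc (l m)" for m
    using assms unfolding alcp_run_def by meson
  then have "l m \<le> l (Suc m)" "l (Suc m) \<le> Suc (l m)" for m
    by (metis le_refl le_Suc_eq)+
  then show "mono l" "l (Suc n) \<le> Suc (l n)" by (auto simp: mono_iff_le_Suc)
  show "l 0 = 0" using assms by (simp add: alcp_run_def)
qed

text \<open>Any later iterate at the last center was accepted silently, as an alarm would raise the
  index above k. The first one is the initial iterate or comes from a recentering, so it is not
  covered by the alarm test and is added as a single point.\<close>

lemma alcp_run_bounded_last_center:
  assumes e: "inj e" and run: "alcp_run e T U V Vt S l" and max: "\<And>n. l n \<le> k"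
  shows "bounded (V ` steps l k)"
proof -
  have "V ` steps l k \<subseteq> insert (V (first_step l k)) {X \<in> Q_space e. \<not> alarming e T X}"
  proof (rule image_subsetI)
    fix n assume n: "n \<in> steps l k"
    let ?m = "first_step l k"
    have m: "?m \<in> steps l k" "?m \<le> n"
      unfolding first_step_def using n by (auto intro: LeastI Least_le)
    show "V n \<in> insert (V ?m) {X \<in> Q_space e. \<not> alarming e T X}"
    proof (cases "n = ?m")
      case False
      then obtain j where j: "n = Suc j" "?m \<le> j" using m(2) by (cases n) auto
      then have "l j = k"
        using monoD[OF alcp_run_index_mono[OF run] j(2)] m(1) max[of j] by (simp add: steps_def)
      then have "\<not> l n = Suc (l j)" using max[of n] by simp
      moreover have "Vt n \<in> Q_space e" "if alarming e T (Vt n)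
          then l n = Suc (l j) \<and> is_center e (U n) (S (Suc (l j))) \<and>
            V n = cayley e (S (Suc (l j))) (U n)
          else l n = l j \<and> V n = Vt n"
        using run unfolding alcp_run_def j(1) by blast+
      ultimately show ?thesis by (auto split: if_splits)
    qed simp
  qed
  then show ?thesis
    by (rule bounded_subset[rotated]) (simp add: bounded_not_alarming[OF e])
qed

text \<open>The index starts at 0 and grows by at most 1, so an unbounded run skips no center. Hence
  the \<open>LEAST\<close> in \<open>first_step\<close> is always attained.\<close>

lemma alcp_run_unbounded_steps:
  assumes run: "alcp_run e T U V Vt S l" and unb: "\<And>K. \<exists>n. K < l n"
  shows "l (first_step l k) = k"
proof -
  obtain n where n: "k < l n" using unb by blast
  \<comment> \<open>At the first time the index reaches k it was below k one step earlier, so it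
    cannot overshoot.\<close>
  define m where "m = (LEAST n. k \<le> l n)"
  have m: "k \<le> l m" using LeastI[of "\<lambda>n. k \<le> l n" n] n by (simp add: m_def)
  have "l m = k"
  proof (cases m)
    case 0
    then show ?thesis using m alcp_run_index_0[OF run] by simp
  next
    case (Suc j)
    then have "\<not> k \<le> l j" using not_less_Least[of j "\<lambda>n. k \<le> l n"] by (simp add: m_def)
    then show ?thesis using m alcp_run_index_Suc[OF run, of j] Suc by simp
  qed
  then show ?thesis using LeastI[of "\<lambda>n. l n = k" m] by (simp add: first_step_def steps_def)
qed

theorem theorem3p9:
  fixes e :: "'p::finite \<Rightarrow> 'n::finite"
    and f :: "real^'p^'n \<Rightarrow> real"
    and L T c :: real
    and U :: "nat \<Rightarrow> real^'p^'n"
    and V Vt D S :: "nat \<Rightarrow> real^'n^'n"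
    and l :: "nat \<Rightarrow> nat"
    and \<gamma> :: "nat \<Rightarrow> real"
    and fS :: "real^'n^'n \<Rightarrow> real^'n^'n \<Rightarrow> real"
    and grad :: "real^'n^'n \<Rightarrow> real^'n^'n \<Rightarrow> real^'n^'n"
  defines "fS \<equiv> \<lambda>C. f \<circ> inv_cayley e C"
    and "grad \<equiv> \<lambda>C. grad_on (Q_space e) (fS C)"
  assumes e: "inj e"
    and f: "\<And>X. f differentiable (at X)"
    and L: "L > 0"
    and lipschitz: "\<And>C V1 V2. orthogonal_matrix C \<Longrightarrow> V1 \<in> Q_space e \<Longrightarrow> V2 \<in> Q_space e \<Longrightarrow>
          norm (grad C V1 - grad C V2) \<le> L * norm (V1 - V2)"
    and T: "T > 0"
    and run: "alcp_run e T U V Vt S l"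
    and c: "0 < c" "c < 1"
    and a_step: "\<And>k n. n \<in> steps l k \<Longrightarrow>
          \<gamma> n > 0 \<and> D n \<in> Q_space e \<and> Vt (Suc n) = V n + \<gamma> n *\<^sub>R D n"
    and a_first: "\<And>k. steps l k \<noteq> {} \<Longrightarrow>
          D (first_step l k) = - grad (S k) (V (first_step l k))"
    and b: "\<And>k n. n \<in> steps l k \<Longrightarrow> grad (S k) (V n) \<noteq> 0 \<Longrightarrow> grad (S k) (V n) \<bullet> D n < 0"
    and c_armijo: "\<And>k n. n \<in> steps l k \<Longrightarrow>
          fS (S k) (V n + \<gamma> n *\<^sub>R D n) \<le> fS (S k) (V n) + c * \<gamma> n * (grad (S k) (V n) \<bullet> D n)"
    and d: "\<And>lh. lh \<in> range l \<Longrightarrow> (\<And>n. l n \<le> lh) \<Longrightarrow> bounded (V ` steps l lh) \<Longrightarrow>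
          Liminf (inf sequentially (principal (steps l lh)))
            (\<lambda>n. ereal (norm (grad (S lh) (V n)))) = 0"
    and ii: "Inf {\<gamma> (first_step l k) | k. steps l k \<noteq> {}} > 0"
    and nonzero: "\<And>n. norm (grad (S (l n)) (V n)) > 0"
  shows "liminf (\<lambda>n. ereal (norm (grad (S (l n)) (V n)))) = 0"
proof (rule ccontr)
  let ?g = "\<lambda>n. ereal (norm (grad (S (l n)) (V n)))"
  assume ne: "liminf ?g \<noteq> 0"
  have "0 \<le> liminf ?g" by (rule Liminf_bounded) simp
  with ne have "0 < liminf ?g" by simp
  \<comment> \<open>A positive lower limit leaves room for a real r that the gradient norms
    eventually exceed.\<close>
  then obtain r where r: "0 < ereal r" "ereal r < liminf ?g" using ereal_dense2 by blast
  then have r0: "0 < r" by simp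
  have ev: "\<forall>\<^sub>F n in sequentially. r < norm (grad (S (l n)) (V n))"
    using less_LiminfD[OF r(2)] by simp
  show False
  proof (cases "\<exists>K. \<forall>n. l n \<le> K")
    case True
    then obtain K where K: "\<And>n. l n \<le> K" by blast
    then have fin: "finite (range l)" by (meson finite_atMost finite_subset image_subsetI atMost_iff)
    \<comment> \<open>K is only a bound, while \<open>d\<close> asks for an index that is
      attained.\<close>
    define k where "k = Max (range l)"
    have k: "k \<in> range l" "\<And>n. l n \<le> k" using fin by (auto simp: k_def)
    let ?F = "inf sequentially (principal (steps l k))"
    have "Liminf ?F (\<lambda>n. ereal (norm (grad (S k) (V n)))) = 0"
      using k by (intro d alcp_run_bounded_last_center[OF e run]) auto
    moreover have "\<forall>\<^sub>F n in ?F. ereal r \<le> ereal (norm (grad (S k) (V n)))"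
      using ev by (auto simp: eventually_inf_principal steps_def elim!: eventually_mono)
    then have "ereal r \<le> Liminf ?F (\<lambda>n. ereal (norm (grad (S k) (V n))))"
      by (rule Liminf_bounded)
    ultimately show False using r0 by simp
  next
    case False
    then have unb: "\<exists>n. K < l n" for K by (meson not_le)
    have lm: "l (first_step l k) = k" for k by (rule alcp_run_unbounded_steps[OF run unb])
    define \<gamma>0 where "\<gamma>0 = Inf {\<gamma> (first_step l k) | k. steps l k \<noteq> {}}"
    have \<gamma>0: "0 < \<gamma>0" using ii by (simp add: \<gamma>0_def)
    have pos: "0 < \<gamma> n" for n using a_step[of n "l n"] by (simp add: steps_def)
    \<comment> \<open>A real \<open>Inf\<close> is a lower bound only for a set that is bounded
      below; positivity of the stepsizes provides the bound 0.\<close>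
    have \<gamma>_ge: "\<gamma>0 \<le> \<gamma> (first_step l k)" for k
      unfolding \<gamma>0_def using lm[of k]
      by (intro cInf_lower bdd_belowI[of _ 0]) (auto simp: steps_def intro: less_imp_le pos)
    have U: "U n \<in> stiefel" "inv_cayley e (S (l n)) (V n) = U n" for n
      using alcp_run_stiefel[OF e run] by auto
    \<comment> \<open>The old center sends both \<open>V n\<close> to \<open>U n\<close> and
      \<open>Vt (Suc n)\<close> to \<open>U (Suc n)\<close>, so the Armijo inequality becomes one
      about f alone and survives a change of center after the step.\<close>
    have descent: "f (U (Suc n)) \<le> f (U n) + c * \<gamma> n * (grad (S (l n)) (V n) \<bullet> D n)" for n
    proof -
      have n: "n \<in> steps l (l n)" by (simp add: steps_def)
      have "U (Suc n) = inv_cayley e (S (l n)) (Vt (Suc n))"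
        using run by (simp add: alcp_run_def)
      then show ?thesis using c_armijo[OF n] a_step[OF n] by (simp add: fS_def U(2))
    qed
    have "decseq (\<lambda>n. f (U n))"
      unfolding decseq_Suc_iff
    proof
      fix n
      have "grad (S (l n)) (V n) \<bullet> D n < 0"
        using nonzero[of n] by (intro b) (auto simp: steps_def)
      then have "c * \<gamma> n * (grad (S (l n)) (V n) \<bullet> D n) \<le> 0"
        using c pos[of n] by (intro mult_nonneg_nonpos) auto
      then show "f (U (Suc n)) \<le> f (U n)" using descent[of n] by simp
    qed
    moreover have "\<exists>B. \<forall>n. B \<le> f (U n)"
    proof -
      have "continuous_on stiefel f"
        using f by (intro differentiable_imp_continuous_on)
          (auto simp: differentiable_on_def intro: differentiable_at_withinI)
      then have "bounded (f ` stiefel)"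
        by (intro compact_imp_bounded compact_continuous_image compact_stiefel)
      then obtain B where "\<And>X. X \<in> stiefel \<Longrightarrow> \<bar>f X\<bar> \<le> B" by (auto simp: bounded_iff)
      then have "- B \<le> f (U n)" for n using U(1)[of n] by (metis abs_le_D2 minus_le_iff)
      then show ?thesis by blast
    qed
    ultimately obtain y where y: "(\<lambda>n. f (U n)) \<longlonglongrightarrow> y"
      by (metis decseq_convergent)
    then have "(\<lambda>n. f (U n) - f (U (Suc n))) \<longlonglongrightarrow> y - y"
      by (intro tendsto_diff LIMSEQ_Suc)
    \<comment> \<open>The threshold is the least decrease that a steepest descent step of size at
      least \<gamma>0 achieves when the gradient norm exceeds r.\<close>
    then have "\<forall>\<^sub>F n in sequentially. f (U n) - f (U (Suc n)) < c * \<gamma>0 * r\<^sup>2"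
      using c \<gamma>0 r0 by (intro order_tendstoD) auto
    with ev have "\<forall>\<^sub>F n in sequentially. f (U n) - f (U (Suc n)) < c * \<gamma>0 * r\<^sup>2
        \<and> r < norm (grad (S (l n)) (V n))"
      by eventually_elim simp
    then obtain N where N: "\<And>n. N \<le> n \<Longrightarrow> f (U n) - f (U (Suc n)) < c * \<gamma>0 * r\<^sup>2
        \<and> r < norm (grad (S (l n)) (V n))"
      unfolding eventually_sequentially by blast
    \<comment> \<open>The center after the one in use at step N: monotonicity of the index puts its
      first step beyond N, where both eventual bounds hold.\<close>
    define k where "k = Suc (l N)"
    define m where "m = first_step l k"
    have m: "l m = k" by (simp add: m_def lm)
    have "N \<le> m"
      using monoD[OF alcp_run_index_mono[OF run], of m N] m by (cases "N \<le> m") (auto simp: k_def)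
    note Nm = N[OF this]
    let ?G = "grad (S k) (V m)"
    have "steps l k \<noteq> {}" using m by (auto simp: steps_def)
    then have "D m = - ?G" using a_first[of k] by (simp add: m_def)
    then have "c * \<gamma> m * (norm ?G)\<^sup>2 \<le> f (U m) - f (U (Suc m))"
      using descent[of m] by (simp add: m power2_norm_eq_inner)
    \<comment> \<open>The decrease at m reaches the threshold that \<open>Nm\<close> says it stays
      below.\<close>
    moreover have "c * \<gamma>0 * r\<^sup>2 \<le> c * \<gamma> m * (norm ?G)\<^sup>2"
      using c \<gamma>0 \<gamma>_ge[of k] Nm r0 m
      by (intro mult_mono power_mono) (auto simp: m_def)
    ultimately show False using Nm by simp
  qed
qed

end
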